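(* Let $X$ be the set of real numbers $\tau$ for which there is $\alpha>1$ such that $\min_{k\in\mathbb{Z}}|j\tau-k|>j^{-\alpha}$ for all but finitely many integers $j>0$. Suppose that $\tau\in X$ and that $z,\sigma\in\mathbb{C}$ satisfy $|\mathrm{Im}(2z-\sigma)|<|\mathrm{Im}\,\sigma|$. Then, as a function of $\epsilon\in\mathbb{R}$, $\Gamma(z,\tau+i\epsilon,\sigma)$, as given by the convergent series \[ \Gamma(z,\tau+i\epsilon,\sigma)=\exp\left(-\frac i2\sum_{j=1}^\infty\frac{\sin(\pi j(2z-\tau-i\epsilon-\sigma))}{j\sin(\pi j(\tau+i\epsilon))\sin(\pi j\sigma)}\right), \] is continuous at $\epsilon=0$.
   Context: Here $\Gamma(z,\tau,\sigma)$ (the elliptic gamma function) is understood as the value of the series \[ \Gamma(z,\tau,\sigma)=\exp\left(-\frac i2\sum_{j=1}^\infty\frac{\sin(\pi j(2z-\tau-\sigma))}{j\sin(\pi j\tau)\sin(\pi j\sigma)}\right) \] whenever it converges absolutely. For $\mathrm{Im}\,\tau,\mathrm{Im}\,\sigma>0$ and $|\mathrm{Im}(2z-\tau-\sigma)|<\mathrm{Im}\,\tau+\mathrm{Im}\,\sigma$ this agrees with the product $\prod_{j,k\ge0}\frac{1-e^{2\pi i((j+1)\tau+(k+1)\sigma-z)}}{1-e^{2\pi i(j\tau+k\sigma+z)}}$. *)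

theory Defs
  imports "HOL-Analysis.Analysis"
begin

text \<open>The minimum over the integers is written as an infimum; it is attained, see below.\<close>

definition int_dist :: "real \<Rightarrow> real" where
  "int_dist x = (INF k::int. \<bar>x - of_int k\<bar>)"

lemma int_dist_le: "int_dist x \<le> \<bar>x - of_int k\<bar>"
  unfolding int_dist_def by (rule cINF_lower) (auto intro: bdd_belowI2[where m = 0])

lemma int_dist_attained: "\<exists>k::int. int_dist x = \<bar>x - of_int k\<bar>"
proof
  have "\<bar>x - of_int (round x)\<bar> \<le> int_dist x"
    unfolding int_dist_def by (rule cINF_greatest) (auto intro: round_diff_minimal)
  with int_dist_le[of x "round x"] show "int_dist x = \<bar>x - of_int (round x)\<bar>"
    by linarith
qed

definition X :: "real set" where
  "X = {\<tau>. \<exists>\<alpha>>1. MOST j::nat. j > 0 \<longrightarrow> int_dist (real j * \<tau>) > real j powr (- \<alpha>)}"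

definition elliptic_gamma_term :: "complex \<Rightarrow> complex \<Rightarrow> complex \<Rightarrow> nat \<Rightarrow> complex" where
  "elliptic_gamma_term z \<tau> \<sigma> j =
     sin (of_real pi * of_nat j * (2 * z - \<tau> - \<sigma>)) /
     (of_nat j * sin (of_real pi * of_nat j * \<tau>) * sin (of_real pi * of_nat j * \<sigma>))"

text \<open>
  The denominators are required not to vanish, since division by zero would otherwise
  silently turn undefined terms into zero. The index shift makes the series start at 1.
\<close>

definition elliptic_gamma_converges :: "complex \<Rightarrow> complex \<Rightarrow> complex \<Rightarrow> bool" where
  "elliptic_gamma_converges z \<tau> \<sigma> \<longleftrightarrow>
     (\<forall>j\<ge>1. sin (of_real pi * of_nat j * \<tau>) \<noteq> 0 \<and> sin (of_real pi * of_nat j * \<sigma>) \<noteq> 0) \<and>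
     summable (\<lambda>j. norm (elliptic_gamma_term z \<tau> \<sigma> (Suc j)))"

text \<open>Meaningful only where \<^const>\<open>elliptic_gamma_converges\<close> holds.\<close>

definition elliptic_gamma :: "complex \<Rightarrow> complex \<Rightarrow> complex \<Rightarrow> complex" where
  "elliptic_gamma z \<tau> \<sigma> = exp (- (\<i> / 2) * (\<Sum>j. elliptic_gamma_term z \<tau> \<sigma> (Suc j)))"

end

theory Submission
  imports Defs "HOL-Real_Asymp.Real_Asymp"
begin

text \<open>
  The idea is a bound on the terms of the series that does not depend on \<open>\<epsilon>\<close>, so that the
  Weierstrass M-test applies on the whole real line. Put \<open>A = \<pi>j(2z - \<sigma>)\<close>,
  \<open>B = \<pi>j(\<tau> + i\<epsilon>)\<close> and \<open>S = \<pi>j\<sigma>\<close>. By the addition formula the \<open>j\<close>-th term is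
  \<open>(sin A cot B - cos A) / (j sin S)\<close>, and \<open>\<epsilon>\<close> enters only through \<open>cot B\<close>. Since
  \<open>|sin w|\<^sup>2 = sin\<^sup>2(Re w) + sinh\<^sup>2(Im w)\<close> and \<open>|cos w|\<^sup>2 = cos\<^sup>2(Re w) + sinh\<^sup>2(Im w)\<close>, one has
  \<open>|cot B| \<le> 1 / |sin(Re B)| = 1 / |sin(\<pi>j\<tau>)|\<close> for every \<open>\<epsilon>\<close> (lemma \<open>norm_cos_mult_sin_Re_le\<close>).

  By Jordan's inequality \<open>|sin(\<pi>x)|\<close> is at least twice the distance from \<open>x\<close> to the integers,
  so the Diophantine condition on \<open>\<tau>\<close> turns this into \<open>|cot B| \<le> j\<^sup>\<alpha>\<close> for large \<open>j\<close>. What remains is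
  \<open>cosh(\<pi>j|Im(2z - \<sigma>)|) / sinh(\<pi>j|Im \<sigma>|)\<close>, which decays exponentially by the hypothesis on
  \<open>z\<close> and \<open>\<sigma>\<close> and absorbs the power of \<open>j\<close>. The terms are continuous in \<open>\<epsilon>\<close> because
  their denominators vanish nowhere: the Diophantine condition excludes rational \<open>\<tau>\<close>, and
  the strict inequality forces \<open>Im \<sigma> \<noteq> 0\<close>.
\<close>

lemma two_times_le_sin_pi:
  fixes t :: real
  assumes "0 \<le> t" "t \<le> 1/2"
  shows "2 * t \<le> sin (pi * t)"
proof -
  have "concave_on {0..1/2} (\<lambda>t. sin (pi * t))"
  proof (rule f''_le0_imp_concave)
    show "((\<lambda>t. sin (pi * t)) has_real_derivative pi * cos (pi * x)) (at x)" for x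
      by (auto intro!: derivative_eq_intros)
    show "((\<lambda>t. pi * cos (pi * t)) has_real_derivative - (pi\<^sup>2 * sin (pi * x))) (at x)" for x
      by (auto intro!: derivative_eq_intros simp: power2_eq_square)
    show "- (pi\<^sup>2 * sin (pi * x)) \<le> 0" if "x \<in> {0..1/2}" for x
      using that by (auto intro!: sin_ge_zero mult_nonneg_nonneg)
  qed auto
  from concave_onD_Icc'[OF this, of t] assms show ?thesis
    by simp
qed

lemma two_times_int_dist_le_abs_sin: "2 * int_dist x \<le> \<bar>sin (pi * x)\<bar>"
proof -
  define d where "d = x - of_int (round x)"
  have "\<bar>d\<bar> \<le> 1/2"
    unfolding d_def using of_int_round_abs_le[of x] by linarith
  then have "2 * \<bar>d\<bar> \<le> sin (pi * \<bar>d\<bar>)"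
    by (intro two_times_le_sin_pi) auto
  also have "\<dots> \<le> \<bar>sin (pi * d)\<bar>"
    by (cases "d \<ge> 0") auto
  also have "sin (pi * d) = sin (pi * x) * cos (pi * of_int (round x))"
    unfolding d_def by (simp add: right_diff_distrib sin_diff)
  also have "\<bar>\<dots>\<bar> \<le> \<bar>sin (pi * x)\<bar>"
    by (simp add: abs_mult mult_left_le)
  finally show ?thesis
    using int_dist_le[of x "round x"] by (simp add: d_def)
qed

lemma norm_sin_squared_sinh: "(norm (sin z))\<^sup>2 = (sin (Re z))\<^sup>2 + (sinh (Im z))\<^sup>2"
  for z :: complex
proof -
  have "exp (2 * Im z) + inverse (exp (2 * Im z)) = 4 * (sinh (Im z))\<^sup>2 + 2"
    unfolding exp_double by (simp add: sinh_field_def exp_minus power2_eq_square field_simps)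
  then show ?thesis
    unfolding norm_sin_squared cos_double_sin by simp
qed

lemma norm_cos_squared_sinh: "(norm (cos z))\<^sup>2 = (cos (Re z))\<^sup>2 + (sinh (Im z))\<^sup>2"
  for z :: complex
  unfolding norm_cos_squared
  by (simp add: sinh_field_def exp_minus power2_eq_square field_simps)

lemma norm_sin_le_cosh: "norm (sin z) \<le> cosh (Im z)"
  for z :: complex
proof (rule power2_le_imp_le)
  show "(norm (sin z))\<^sup>2 \<le> (cosh (Im z))\<^sup>2"
    unfolding norm_sin_squared_sinh cosh_square_eq using sin_squared_eq[of "Re z"] by simp
qed simp

lemma norm_cos_le_cosh: "norm (cos z) \<le> cosh (Im z)"
  for z :: complex
proof (rule power2_le_imp_le)
  show "(norm (cos z))\<^sup>2 \<le> (cosh (Im z))\<^sup>2"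
    unfolding norm_cos_squared_sinh cosh_square_eq using cos_squared_eq[of "Re z"] by simp
qed simp

lemma abs_sinh_Im_le_norm_sin: "\<bar>sinh (Im z)\<bar> \<le> norm (sin z)"
  for z :: complex
  by (rule power2_le_imp_le) (auto simp: norm_sin_squared_sinh)

lemma abs_sin_Re_le_norm_sin: "\<bar>sin (Re z)\<bar> \<le> norm (sin z)"
  for z :: complex
  by (rule power2_le_imp_le) (auto simp: norm_sin_squared_sinh)

text \<open>The bound \<open>|cot z| \<le> 1 / |sin(Re z)|\<close>, with denominators cleared; it is uniform in the
  imaginary part of \<open>z\<close>.\<close>

lemma norm_cos_mult_sin_Re_le: "norm (cos z) * \<bar>sin (Re z)\<bar> \<le> norm (sin z)"
  for z :: complex
proof (rule power2_le_imp_le)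
  have "(sin (Re z))\<^sup>2 \<le> 1"
    by (simp add: sin_squared_eq)
  then have "(cos (Re z))\<^sup>2 * (sin (Re z))\<^sup>2 \<le> 1 * (sin (Re z))\<^sup>2"
    and "(sinh (Im z))\<^sup>2 * (sin (Re z))\<^sup>2 \<le> (sinh (Im z))\<^sup>2 * 1"
    by (intro mult_mono; simp add: cos_squared_eq)+
  then show "(norm (cos z) * \<bar>sin (Re z)\<bar>)\<^sup>2 \<le> (norm (sin z))\<^sup>2"
    by (simp add: power_mult_distrib norm_sin_squared_sinh norm_cos_squared_sinh distrib_right)
qed simp

lemma X_sin_nonzero:
  assumes "\<tau> \<in> X" "j \<ge> 1"
  shows "sin (pi * real j * \<tau>) \<noteq> 0"
proof
  assume "sin (pi * real j * \<tau>) = 0"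
  then obtain i :: int where i: "real j * \<tau> = of_int i"
    by (auto simp: sin_zero_iff_int2)
  from assms(1) obtain \<alpha> N where
    N: "\<And>n::nat. n > N \<Longrightarrow> n > 0 \<longrightarrow> int_dist (real n * \<tau>) > real n powr (- \<alpha>)"
    unfolding X_def MOST_nat by blast
  \<comment> \<open>If \<open>j\<tau>\<close> is an integer, so are all its multiples, and infinitely many distances vanish.\<close>
  define n where "n = Suc N * j"
  have "n > N"
    using \<open>j \<ge> 1\<close> mult_le_mono2[of 1 j "Suc N"] by (simp add: n_def)
  then have "int_dist (real n * \<tau>) > real n powr (- \<alpha>)"
    using N by simp
  moreover have "real n * \<tau> = of_int (int (Suc N) * i)"
    unfolding n_def of_nat_mult mult.assoc i by simp
  then have "int_dist (real n * \<tau>) \<le> 0"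
    using int_dist_le[of "real n * \<tau>" "int (Suc N) * i"] by simp
  ultimately show False
    using powr_ge_zero[of "real n" "- \<alpha>"] by linarith
qed

lemma X_eventually_sin_bound:
  assumes "\<tau> \<in> X"
  obtains \<alpha> where "\<alpha> > 1"
    "eventually (\<lambda>j. 1 / \<bar>sin (pi * real j * \<tau>)\<bar> \<le> real j powr \<alpha>) sequentially"
proof -
  from assms obtain \<alpha> N where "\<alpha> > 1" and
    N: "\<And>n::nat. n > N \<Longrightarrow> n > 0 \<longrightarrow> int_dist (real n * \<tau>) > real n powr (- \<alpha>)"
    unfolding X_def MOST_nat by blast
  have "1 / \<bar>sin (pi * real j * \<tau>)\<bar> \<le> real j powr \<alpha>" if "j > N" for j
  proof -
    have pos: "0 < real j powr (- \<alpha>)"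
      using that by simp
    have "real j powr (- \<alpha>) \<le> \<bar>sin (pi * real j * \<tau>)\<bar>"
      using N[OF that] that pos two_times_int_dist_le_abs_sin[of "real j * \<tau>"]
      by (simp add: mult.assoc)
    then have "1 / \<bar>sin (pi * real j * \<tau>)\<bar> \<le> 1 / real j powr (- \<alpha>)"
      using pos by (intro divide_left_mono mult_pos_pos) auto
    then show ?thesis
      by (simp add: powr_minus_divide)
  qed
  then have "eventually (\<lambda>j. 1 / \<bar>sin (pi * real j * \<tau>)\<bar> \<le> real j powr \<alpha>) sequentially"
    using eventually_gt_at_top[of N] by (rule eventually_mono[rotated])
  with \<open>\<alpha> > 1\<close> that show thesis
    by blast
qed

text \<open>The right-hand side depends on \<open>\<tau>\<close> through its real part only.\<close>

lemma norm_elliptic_gamma_term_le: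
  assumes "j \<ge> 1" "sin (pi * real j * Re \<tau>) \<noteq> 0" "Im \<sigma> \<noteq> 0"
  shows "norm (elliptic_gamma_term z \<tau> \<sigma> j) \<le>
    cosh (pi * real j * \<bar>Im (2 * z - \<sigma>)\<bar>) * (1 + 1 / \<bar>sin (pi * real j * Re \<tau>)\<bar>) /
    (real j * sinh (pi * real j * \<bar>Im \<sigma>\<bar>))"
proof -
  define A where "A = of_real pi * of_nat j * (2 * z - \<sigma>)"
  define B where "B = of_real pi * of_nat j * \<tau>"
  define S where "S = of_real pi * of_nat j * \<sigma>"
  define q where "q = \<bar>sin (Re B)\<bar>"
  have Re_B: "Re B = pi * real j * Re \<tau>" and Im_A: "Im A = pi * real j * Im (2 * z - \<sigma>)"
    and Im_S: "Im S = pi * real j * Im \<sigma>"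
    by (simp_all add: A_def B_def S_def)
  have q: "q > 0"
    using assms by (simp add: q_def Re_B)
  have sinB: "norm (sin B) > 0"
    using q abs_sin_Re_le_norm_sin[of B] unfolding q_def by linarith
  have cosB: "norm (cos B) \<le> norm (sin B) * (1 / q)"
    using norm_cos_mult_sin_Re_le[of B] q by (simp add: q_def field_simps)
  have "norm (sin (A - B)) \<le> norm (sin A * cos B) + norm (cos A * sin B)"
    unfolding sin_diff by (rule norm_triangle_ineq4)
  also have "\<dots> \<le> cosh (Im A) * (norm (sin B) * (1 / q)) + cosh (Im A) * norm (sin B)"
    unfolding norm_mult
    by (intro add_mono mult_mono norm_sin_le_cosh norm_cos_le_cosh cosB) auto
  finally have num: "norm (sin (A - B)) \<le> cosh (Im A) * (1 + 1 / q) * norm (sin B)"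
    by (simp add: algebra_simps)
  have "\<bar>Im S\<bar> > 0"
    using assms by (simp add: Im_S)
  then have sinh_pos: "sinh \<bar>Im S\<bar> > 0"
    by simp
  have sinS: "sinh \<bar>Im S\<bar> \<le> norm (sin S)"
    using abs_sinh_Im_le_norm_sin[of S] by simp
  have "elliptic_gamma_term z \<tau> \<sigma> j = sin (A - B) / (of_nat j * sin B * sin S)"
    by (simp add: elliptic_gamma_term_def A_def B_def S_def algebra_simps)
  then have "norm (elliptic_gamma_term z \<tau> \<sigma> j) =
      norm (sin (A - B)) / (real j * norm (sin B) * norm (sin S))"
    by (simp add: norm_mult norm_divide)
  also have "\<dots> \<le> (cosh (Im A) * (1 + 1 / q) * norm (sin B)) /
      (real j * norm (sin B) * sinh \<bar>Im S\<bar>)"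
    using num sinS sinh_pos sinB assms(1) q
    by (intro frac_le mult_left_mono mult_pos_pos mult_nonneg_nonneg add_nonneg_nonneg) auto
  also have "\<dots> = cosh (Im A) * (1 + 1 / q) / (real j * sinh \<bar>Im S\<bar>)"
    using sinB by simp
  also have "cosh (Im A) = cosh \<bar>Im A\<bar>"
    by simp
  also have "\<bar>Im A\<bar> = pi * real j * \<bar>Im (2 * z - \<sigma>)\<bar>"
    unfolding Im_A by (simp add: abs_mult)
  also have "\<bar>Im S\<bar> = pi * real j * \<bar>Im \<sigma>\<bar>"
    unfolding Im_S by (simp add: abs_mult)
  finally show ?thesis
    by (simp add: q_def Re_B)
qed

lemma summable_cosh_over_sinh_powr:
  fixes a s \<alpha> :: real
  assumes "0 \<le> a" "a < s" "\<alpha> > 1"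
  shows "summable (\<lambda>j. cosh (pi * real j * a) * (1 + real j powr \<alpha>) / (real j * sinh (pi * real j * s)))"
proof (rule summable_comparison_test_ev)
  define d where "d = pi * (s - a)"
  have "d > 0"
    using assms by (simp add: d_def)
  show "summable (\<lambda>j. 4 * (exp (- (d * real j)) * (1 + real j powr \<alpha>)))"
  proof (rule summable_comparison_test_bigo)
    show "summable (\<lambda>j. norm (1 / real j ^ 2))"
      using inverse_power_summable[of 2, where 'a = real] by (simp add: field_simps)
    show "(\<lambda>j. 4 * (exp (- (d * real j)) * (1 + real j powr \<alpha>))) \<in> O(\<lambda>j. 1 / real j ^ 2)"
      using \<open>d > 0\<close> \<open>\<alpha> > 1\<close> by real_asymp
  qed
  have "s > 0"
    using assms by simp
  have "eventually (\<lambda>j. exp (pi * real j * s) / 4 \<le> sinh (pi * real j * s)) sequentially"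
    using \<open>s > 0\<close> by real_asymp
  then show "eventually (\<lambda>j. norm (cosh (pi * real j * a) * (1 + real j powr \<alpha>) /
      (real j * sinh (pi * real j * s))) \<le> 4 * (exp (- (d * real j)) * (1 + real j powr \<alpha>))) sequentially"
    using eventually_ge_at_top[of 1]
  proof eventually_elim
    case (elim j)
    have "cosh (pi * real j * a) \<le> exp (pi * real j * a)"
      using assms(1) by (simp add: cosh_field_def)
    moreover have "1 * sinh (pi * real j * s) \<le> real j * sinh (pi * real j * s)"
      using elim \<open>s > 0\<close> by (intro mult_right_mono) auto
    with elim(1) have "exp (pi * real j * s) / 4 \<le> real j * sinh (pi * real j * s)"
      by linarith
    ultimately have "cosh (pi * real j * a) * (1 + real j powr \<alpha>) / (real j * sinh (pi * real j * s))
        \<le> exp (pi * real j * a) * (1 + real j powr \<alpha>) / (exp (pi * real j * s) / 4)"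
      by (intro frac_le mult_right_mono) auto
    also have "\<dots> = 4 * (exp (- (d * real j)) * (1 + real j powr \<alpha>))"
      by (simp add: d_def exp_diff exp_minus field_simps)
    finally show ?case
      using elim \<open>s > 0\<close> by (simp add: abs_mult)
  qed
qed

theorem theorem3p5:
  fixes \<tau> :: real and z \<sigma> :: complex
  assumes "\<tau> \<in> X"
    and "\<bar>Im (2 * z - \<sigma>)\<bar> < \<bar>Im \<sigma>\<bar>"
  shows "(\<forall>\<epsilon>::real. elliptic_gamma_converges z (of_real \<tau> + \<i> * of_real \<epsilon>) \<sigma>) \<and>
         isCont (\<lambda>\<epsilon>::real. elliptic_gamma z (of_real \<tau> + \<i> * of_real \<epsilon>) \<sigma>) 0"
proof -
  define f where "f = (\<lambda>j (\<epsilon>::real). elliptic_gamma_term z (of_real \<tau> + \<i> * of_real \<epsilon>) \<sigma> (Suc j))"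
  have \<sigma>: "Im \<sigma> \<noteq> 0"
    using assms(2) by auto
  obtain \<alpha> where \<alpha>: "\<alpha> > 1"
    "eventually (\<lambda>j. 1 / \<bar>sin (pi * real j * \<tau>)\<bar> \<le> real j powr \<alpha>) sequentially"
    using X_eventually_sin_bound[OF assms(1)] .
  define M where "M = (\<lambda>j. cosh (pi * real j * \<bar>Im (2 * z - \<sigma>)\<bar>) * (1 + real j powr \<alpha>) /
    (real j * sinh (pi * real j * \<bar>Im \<sigma>\<bar>)))"
  have "summable M"
    unfolding M_def using assms(2) \<alpha>(1) by (intro summable_cosh_over_sinh_powr) auto
  then have M: "summable (\<lambda>j. M (Suc j))"
    by (simp add: summable_Suc_iff)
  have nz: "sin (of_real pi * of_nat j * (of_real \<tau> + \<i> * of_real \<epsilon>)) \<noteq> 0"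
    "sin (of_real pi * of_nat j * \<sigma>) \<noteq> 0" if "j \<ge> 1" for j and \<epsilon> :: real
  proof -
    show "sin (of_real pi * of_nat j * (of_real \<tau> + \<i> * of_real \<epsilon>)) \<noteq> 0"
      using X_sin_nonzero[OF assms(1) that]
        abs_sin_Re_le_norm_sin[of "of_real pi * of_nat j * (of_real \<tau> + \<i> * of_real \<epsilon>)"]
      by auto
    show "sin (of_real pi * of_nat j * \<sigma>) \<noteq> 0"
      using \<sigma> that abs_sinh_Im_le_norm_sin[of "of_real pi * of_nat j * \<sigma>"] by auto
  qed
  have "eventually (\<lambda>j. \<forall>\<epsilon>\<in>UNIV. norm (elliptic_gamma_term z (of_real \<tau> + \<i> * of_real \<epsilon>) \<sigma> j) \<le> M j)
      sequentially"
    using \<alpha>(2) eventually_ge_at_top[of 1]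
  proof eventually_elim
    case (elim j)
    show ?case
    proof
      fix \<epsilon> :: real
      have "norm (elliptic_gamma_term z (of_real \<tau> + \<i> * of_real \<epsilon>) \<sigma> j) \<le>
          cosh (pi * real j * \<bar>Im (2 * z - \<sigma>)\<bar>) * (1 + 1 / \<bar>sin (pi * real j * \<tau>)\<bar>) /
          (real j * sinh (pi * real j * \<bar>Im \<sigma>\<bar>))"
        using norm_elliptic_gamma_term_le[of j "of_real \<tau> + \<i> * of_real \<epsilon>" \<sigma> z]
          X_sin_nonzero[OF assms(1) elim(2)] elim(2) \<sigma> by simp
      also have "\<dots> \<le> M j"
        unfolding M_def using elim(1)
        by (intro divide_right_mono mult_left_mono add_left_mono) auto
      finally show "norm (elliptic_gamma_term z (of_real \<tau> + \<i> * of_real \<epsilon>) \<sigma> j) \<le> M j" .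
    qed
  qed
  then have bound: "eventually (\<lambda>j. \<forall>\<epsilon>\<in>UNIV. norm (f j \<epsilon>) \<le> M (Suc j)) sequentially"
    unfolding f_def by (rule eventually_compose_filterlim[OF _ filterlim_Suc])
  have "summable (\<lambda>j. norm (f j \<epsilon>))" for \<epsilon>
    by (rule summable_comparison_test_ev[OF _ M]) (use bound in eventually_elim, simp)
  then have conv: "elliptic_gamma_converges z (of_real \<tau> + \<i> * of_real \<epsilon>) \<sigma>" for \<epsilon> :: real
    using nz unfolding elliptic_gamma_converges_def f_def by blast
  have "uniform_limit UNIV (\<lambda>n \<epsilon>. \<Sum>j<n. f j \<epsilon>) (\<lambda>\<epsilon>. \<Sum>j. f j \<epsilon>) sequentially"
    by (rule Weierstrass_m_test_ev[OF bound M])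
  moreover have "continuous_on UNIV (f j)" for j
    unfolding f_def elliptic_gamma_term_def
    by (intro continuous_intros) (use nz[of "Suc j"] in auto)
  then have "eventually (\<lambda>n. continuous_on UNIV (\<lambda>\<epsilon>. \<Sum>j<n. f j \<epsilon>)) sequentially"
    by (intro always_eventually allI continuous_on_sum)
  ultimately have "continuous_on UNIV (\<lambda>\<epsilon>. \<Sum>j. f j \<epsilon>)"
    by (intro uniform_limit_theorem) auto
  then have "continuous_on UNIV (\<lambda>\<epsilon>::real. elliptic_gamma z (of_real \<tau> + \<i> * of_real \<epsilon>) \<sigma>)"
    unfolding elliptic_gamma_def f_def by (intro continuous_intros)
  then show ?thesis
    using conv by (simp add: continuous_on_eq_continuous_at)
qed

end
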